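(* Let $(X_n)_{n\geq 1}$ be a sequence of random variables such that, for each $n$, $X_n$ is a uniformly chosen random permutation in the symmetric group $S_n$. For $\sigma\in S_n$, let $\mathrm{Fix}(\sigma)\subset\{1,\dots,n\}$ denote the set of fixed points of $\sigma$. Then the sequence $(|\mathrm{Fix}(X_n)|)_{n\geq 1}$ converges in law, as $n\to+\infty$, to a Poisson distribution with parameter $1$.
   Context: The Poisson distribution with parameter a real number $\lambda>0$ is the measure $P_\lambda$ supported on non-negative integers given by $P_\lambda(\{r\})=e^{-\lambda}\lambda^r/r!$ for all integers $r\geq 0$. *)

theory Defs
  imports "HOL-Probability.Probability" "HOL-Combinatorics.Permutations"
begin

text \<open>
  Elements of the symmetric group on \<open>{1..n}\<close> are represented, as usual in the library, by
  functions on all of \<open>nat\<close> that are the identity outside \<open>{1..n}\<close>; fixed points are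
  therefore only counted inside \<open>{1..n}\<close>.
\<close>

definition symgroup :: "nat \<Rightarrow> (nat \<Rightarrow> nat) set" where
  "symgroup n = {\<sigma>. \<sigma> permutes {1..n}}"

definition Fix :: "nat \<Rightarrow> (nat \<Rightarrow> nat) \<Rightarrow> nat set" where
  "Fix n \<sigma> = {i \<in> {1..n}. \<sigma> i = i}"

definition uniform_random_perm :: "'a measure \<Rightarrow> nat \<Rightarrow> ('a \<Rightarrow> nat \<Rightarrow> nat) \<Rightarrow> bool" where
  "uniform_random_perm M n X \<longleftrightarrow>
     X \<in> measurable M (count_space (symgroup n)) \<and>
     distr M (count_space (symgroup n)) X = uniform_count_measure (symgroup n)"

text \<open>The Poisson distribution regarded as a Borel measure on the reals; meaningful for
  positive \<open>rate\<close> only, as \<open>poisson_pmf\<close> is.\<close>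

definition poisson_measure :: "real \<Rightarrow> real measure" where
  "poisson_measure rate = distr (measure_pmf (poisson_pmf rate)) borel real"

text \<open>
  Convergence in law only involves the laws of the variables, so the \<open>n\<close>-th variable may live on
  its own probability space \<open>M n\<close>.
\<close>

definition converges_in_law ::
  "(nat \<Rightarrow> 'a measure) \<Rightarrow> (nat \<Rightarrow> 'a \<Rightarrow> real) \<Rightarrow> real measure \<Rightarrow> bool" where
  "converges_in_law M Y \<mu> \<longleftrightarrow> weak_conv_m (\<lambda>n. distr (M n) borel (Y n)) \<mu>"

end

theory Submission
  imports Defs
begin

text \<open>
  A permutation of an \<open>n\<close>-element set is determined by the set \<open>B\<close> of its fixed points together
  with a derangement of the complement of \<open>B\<close>. Hence, if \<open>D m\<close> is the number of derangements of
  an \<open>m\<close>-element set, exactly \<open>(n choose k) * D (n - k)\<close> permutations have \<open>k\<close> fixed points, and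
  the probability of this event is \<open>(1 / k!) * (D (n - k) / (n - k)!)\<close>
  (lemma \<open>proportion_with_k_fixpoints\<close>).

  Summing over all possible \<open>B\<close> expresses \<open>n!\<close> through the derangement numbers of the subsets;
  Moebius inversion on the lattice of subsets turns this around and gives
  \<open>D m / m! = (\<Sum>j\<le>m. (-1) ^ j / j!)\<close> (lemma \<open>derangement_proportion\<close>), a partial sum of the
  exponential series at \<open>-1\<close>. So for every fixed \<open>k\<close> the probability of \<open>k\<close> fixed points tends
  to \<open>exp (-1) / k!\<close>, the mass that the Poisson law of parameter \<open>1\<close> gives to \<open>k\<close>.

  This is enough for convergence in law: the distribution function at \<open>x\<close> of a law carried by the
  natural numbers is the sum of the finitely many point masses at integers \<open>k \<le> x\<close>
  (lemma \<open>cdf_distr_nat\<close>), so distribution functions converge at every point.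
\<close>

section \<open>Counting derangements\<close>

definition derangements :: "'a set \<Rightarrow> ('a \<Rightarrow> 'a) set" where
  "derangements A = {\<sigma>. \<sigma> permutes A \<and> (\<forall>x\<in>A. \<sigma> x \<noteq> x)}"

text \<open>
  A permutation of \<open>A\<close> that fixes \<open>B\<close> pointwise already permutes \<open>A - B\<close> in the sense of
  \<open>permutes\<close>, because that predicate only asks for the identity outside the set. So no
  restriction map is needed and the correspondence is an equality of sets.
\<close>

lemma permutes_with_fixpoints_eq_derangements:
  assumes "B \<subseteq> A"
  shows "{\<sigma>. \<sigma> permutes A \<and> {x \<in> A. \<sigma> x = x} = B} = derangements (A - B)"
proof (intro set_eqI iffI)
  fix \<sigma> assume "\<sigma> \<in> {\<sigma>. \<sigma> permutes A \<and> {x \<in> A. \<sigma> x = x} = B}"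
  then have "\<sigma> permutes A" and B: "{x \<in> A. \<sigma> x = x} = B" by auto
  then have "\<sigma> permutes (A - B)" by (auto intro: permutes_superset)
  with B show "\<sigma> \<in> derangements (A - B)" by (auto simp: derangements_def)
next
  fix \<sigma> assume "\<sigma> \<in> derangements (A - B)"
  then have \<sigma>: "\<sigma> permutes (A - B)" and "\<forall>x\<in>A - B. \<sigma> x \<noteq> x"
    by (auto simp: derangements_def)
  with assms have "{x \<in> A. \<sigma> x = x} = B" by (auto simp: permutes_not_in[OF \<sigma>])
  moreover have "\<sigma> permutes A" using permutes_subset[OF \<sigma>] by auto
  ultimately show "\<sigma> \<in> {\<sigma>. \<sigma> permutes A \<and> {x \<in> A. \<sigma> x = x} = B}" by auto
qed

text \<open>
  With \<open>P\<close> trivial this decomposes the whole symmetric group, the input of the Moebius inversion;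
  with \<open>P\<close> a condition on the cardinality it counts permutations with \<open>k\<close> fixed points.
\<close>

lemma card_permutations_by_fixpoints:
  assumes "finite A"
  shows "card {\<sigma>. \<sigma> permutes A \<and> P {x \<in> A. \<sigma> x = x}} =
    (\<Sum>B | B \<subseteq> A \<and> P B. card (derangements (A - B)))"
proof -
  let ?S = "{\<sigma>. \<sigma> permutes A \<and> P {x \<in> A. \<sigma> x = x}}"
  let ?fix = "\<lambda>\<sigma>. {x \<in> A. \<sigma> x = x}"
  have "finite ?S"
    by (rule finite_subset[OF _ finite_permutations[OF assms]]) auto
  then have "card ?S = (\<Sum>B | B \<subseteq> A \<and> P B. card {\<sigma> \<in> ?S. ?fix \<sigma> = B})"
    using sum.group[of ?S "{B. B \<subseteq> A \<and> P B}" ?fix "\<lambda>_. 1::nat"] assms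
    by (simp add: image_subset_iff)
  also have "\<dots> = (\<Sum>B | B \<subseteq> A \<and> P B. card (derangements (A - B)))"
  proof (rule sum.cong[OF refl])
    fix B assume "B \<in> {B. B \<subseteq> A \<and> P B}"
    then have "{\<sigma> \<in> ?S. ?fix \<sigma> = B} = {\<sigma>. \<sigma> permutes A \<and> ?fix \<sigma> = B}" by auto
    then show "card {\<sigma> \<in> ?S. ?fix \<sigma> = B} = card (derangements (A - B))"
      using permutes_with_fixpoints_eq_derangements[of B A] \<open>B \<in> _\<close> by simp
  qed
  finally show ?thesis .
qed

lemma sum_Pow_by_card:
  fixes f :: "nat \<Rightarrow> 'b::comm_semiring_1"
  assumes "finite A"
  shows "(\<Sum>B\<in>Pow A. f (card B)) = (\<Sum>k\<le>card A. of_nat (card A choose k) * f k)"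
proof -
  have "(\<Sum>B\<in>Pow A. f (card B)) = (\<Sum>k\<le>card A. \<Sum>B\<in>{B \<in> Pow A. card B = k}. f (card B))"
    using assms by (intro sum.group[symmetric]) (auto intro: card_mono)
  also have "\<dots> = (\<Sum>k\<le>card A. of_nat (card A choose k) * f k)"
    using assms by (intro sum.cong) (auto simp: n_subsets)
  finally show ?thesis .
qed

text \<open>
  Every permutation of \<open>A\<close> is a derangement of exactly one subset of \<open>A\<close>, its support, so the
  factorials are the sums over subsets of the derangement numbers. Moebius inversion yields
  \<open>D A = (\<Sum>k\<le>n. (n choose k) * (-1) ^ (n - k) * k!)\<close> with \<open>n = card A\<close>; dividing by \<open>n!\<close>
  cancels the factorial of \<open>k\<close> against the one in the binomial coefficient.
\<close>

lemma derangement_proportion: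
  assumes "finite A"
  shows "real (card (derangements A)) / fact (card A) = (\<Sum>j\<le>card A. (-1) ^ j / fact j)"
proof -
  let ?n = "card A"
  have fact_eq: "(fact (card S) :: real) = (\<Sum>B\<in>Pow S. real (card (derangements B)))"
    if "finite S" for S :: "'a set"
  proof -
    have "card {\<sigma>. \<sigma> permutes S} = (\<Sum>B\<in>Pow S. card (derangements (S - B)))"
      using card_permutations_by_fixpoints[OF that, of "\<lambda>_. True"] by (simp add: Pow_def)
    \<comment> \<open>Pass from the set of fixed points to its complement, the support.\<close>
    also have "\<dots> = (\<Sum>B\<in>Pow S. card (derangements B))"
      by (rule sum.reindex_bij_witness[of _ "\<lambda>B. S - B" "\<lambda>B. S - B"]) (auto simp: double_diff)
    finally have "fact (card S) = (\<Sum>B\<in>Pow S. card (derangements B))"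
      using card_permutations[OF refl that] by simp
    then have "real (fact (card S)) = real (\<Sum>B\<in>Pow S. card (derangements B))"
      by (rule arg_cong)
    then show ?thesis by simp
  qed
  have "real (card (derangements A)) = (\<Sum>B\<in>Pow A. (-1) ^ (?n - card B) * fact (card B))"
    using inclusion_exclusion_mobius[of "\<lambda>S. fact (card S)" "\<lambda>B. real (card (derangements B))"]
      fact_eq assms by blast
  also have "\<dots> = (\<Sum>k\<le>?n. real (?n choose k) * ((-1) ^ (?n - k) * fact k))"
    using assms by (rule sum_Pow_by_card)
  also have "\<dots> = (\<Sum>k\<le>?n. fact ?n * ((-1) ^ (?n - k) / fact (?n - k)))"
    by (intro sum.cong) (simp_all add: binomial_fact)
  also have "\<dots> = fact ?n * (\<Sum>j\<le>?n. (-1) ^ j / fact j)"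
    unfolding sum_distrib_left
    by (rule sum.reindex_bij_witness[of _ "\<lambda>j. ?n - j" "\<lambda>k. ?n - k"]) auto
  finally show ?thesis by simp
qed

section \<open>The law of the number of fixed points\<close>

text \<open>
  All the sets \<open>B\<close> of \<open>k\<close> fixed points contribute the same number of derangements, and
  \<open>(n choose k) * (n - k)! = n! / k!\<close> leaves the factor \<open>1 / k!\<close>.
\<close>

lemma proportion_with_k_fixpoints:
  assumes "finite A" and "k \<le> card A"
  shows "real (card {\<sigma>. \<sigma> permutes A \<and> card {x \<in> A. \<sigma> x = x} = k}) / fact (card A) =
    (\<Sum>j\<le>card A - k. (-1) ^ j / fact j) / fact k"
proof -
  let ?n = "card A"
  let ?s = "\<Sum>j\<le>?n - k. (-1) ^ j / fact j :: real"
  have "real (card (derangements (A - B))) = fact (?n - k) * ?s" if "B \<subseteq> A" "card B = k" for B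
    using derangement_proportion[of "A - B"] that assms
    by (simp add: card_Diff_subset finite_subset field_simps)
  then have "real (card {\<sigma>. \<sigma> permutes A \<and> card {x \<in> A. \<sigma> x = x} = k}) =
      (\<Sum>B | B \<subseteq> A \<and> card B = k. fact (?n - k) * ?s)"
    using card_permutations_by_fixpoints[OF assms(1), of "\<lambda>B. card B = k"] by simp
  also have "\<dots> = real (?n choose k) * (fact (?n - k) * ?s)"
    using assms(1) by (simp add: n_subsets)
  also have "\<dots> = fact ?n * (?s / fact k)"
    using assms(2) by (simp add: binomial_fact)
  finally show ?thesis by simp
qed

lemma uniform_random_perm_prob:
  assumes "uniform_random_perm M n X"
  shows "measure M (X -` {\<sigma>. \<sigma> permutes {1..n} \<and> P \<sigma>} \<inter> space M) =
    real (card {\<sigma>. \<sigma> permutes {1..n} \<and> P \<sigma>}) / fact n"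
proof -
  let ?E = "{\<sigma>. \<sigma> permutes {1..n} \<and> P \<sigma>}"
  have X: "X \<in> measurable M (count_space (symgroup n))"
    and law: "distr M (count_space (symgroup n)) X = uniform_count_measure (symgroup n)"
    using assms by (auto simp: uniform_random_perm_def)
  have fin: "finite (symgroup n)" and card: "card (symgroup n) = fact n"
    by (auto simp: symgroup_def finite_permutations card_permutations)
  have E: "?E \<subseteq> symgroup n" by (auto simp: symgroup_def)
  have "measure M (X -` ?E \<inter> space M) = measure (uniform_count_measure (symgroup n)) ?E"
    using measure_distr[OF X, of ?E] E by (simp add: law)
  then show ?thesis
    using measure_uniform_count_measure[OF fin E] card by simp
qed

section \<open>Weak convergence of laws carried by the natural numbers\<close>

text \<open>
  Only finitely many naturals lie below \<open>x\<close>, so pointwise convergence of the point masses passes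
  to distribution functions without any tightness or domination argument.
\<close>

lemma cdf_distr_nat:
  assumes "finite_measure M" and Y: "Y \<in> measurable M (count_space (UNIV :: nat set))"
  shows "cdf (distr M borel (\<lambda>\<omega>. real (Y \<omega>))) x =
    (\<Sum>k | real k \<le> x. measure M (Y -` {k} \<inter> space M))"
proof -
  interpret finite_measure M by fact
  have fin: "finite {k. real k \<le> x}"
    by (rule finite_subset[of _ "{..nat \<lfloor>x\<rfloor>}"]) (auto simp: le_nat_floor)
  have "(\<lambda>\<omega>. real (Y \<omega>)) \<in> borel_measurable M"
    using Y by measurable
  then have "cdf (distr M borel (\<lambda>\<omega>. real (Y \<omega>))) x =
      measure M (\<Union>k\<in>{k. real k \<le> x}. Y -` {k} \<inter> space M)"
    by (simp add: cdf_def2 measure_distr) (rule arg_cong[where f = "measure M"]; auto)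
  also have "\<dots> = (\<Sum>k | real k \<le> x. measure M (Y -` {k} \<inter> space M))"
    using fin Y by (intro finite_measure_finite_Union)
      (auto simp: disjoint_family_on_def intro: measurable_sets)
  finally show ?thesis .
qed

section \<open>Convergence to the Poisson distribution\<close>

theorem theorem1p4:
  fixes M :: "nat \<Rightarrow> 'a measure" and X :: "nat \<Rightarrow> 'a \<Rightarrow> (nat \<Rightarrow> nat)"
  assumes "\<And>n. n \<ge> 1 \<Longrightarrow> prob_space (M n)"
    and "\<And>n. n \<ge> 1 \<Longrightarrow> uniform_random_perm (M n) n (X n)"
  shows "converges_in_law M (\<lambda>n \<omega>. real (card (Fix n (X n \<omega>)))) (poisson_measure 1)"
proof -
  define Y where "Y n \<omega> = card (Fix n (X n \<omega>))" for n \<omega>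
  define p where "p n k = measure (M n) (Y n -` {k} \<inter> space (M n))" for n k
  have Y: "Y n \<in> measurable (M n) (count_space UNIV)" if "n \<ge> 1" for n
  proof -
    have "X n \<in> measurable (M n) (count_space (symgroup n))"
      using assms(2)[OF that] by (simp add: uniform_random_perm_def)
    then show ?thesis
      unfolding Y_def by (rule measurable_compose) simp
  qed
  have p_eq: "p n k = (\<Sum>j\<le>n - k. (-1) ^ j / fact j) / fact k" if "n \<ge> 1" "k \<le> n" for n k
  proof -
    let ?E = "{\<sigma>. \<sigma> permutes {1..n} \<and> card {x \<in> {1..n}. \<sigma> x = x} = k}"
    have "X n \<omega> permutes {1..n}" if "\<omega> \<in> space (M n)" for \<omega>
      using assms(2)[OF \<open>n \<ge> 1\<close>] that
      by (auto simp: uniform_random_perm_def symgroup_def dest: measurable_space)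
    then have "Y n -` {k} \<inter> space (M n) = X n -` ?E \<inter> space (M n)"
      by (auto simp: Y_def Fix_def)
    then have "p n k = real (card ?E) / fact n"
      unfolding p_def using uniform_random_perm_prob[OF assms(2)[OF \<open>n \<ge> 1\<close>]] by simp
    then show ?thesis
      using proportion_with_k_fixpoints[of "{1..n}" k] \<open>k \<le> n\<close> by simp
  qed
  have p_lim: "(\<lambda>n. p n k) \<longlonglongrightarrow> pmf (poisson_pmf 1) k" for k
  proof -
    have "(\<lambda>j. (-1) ^ j / fact j) sums exp (-1 :: real)"
      using exp_converges[of "-1 :: real"] by (simp add: divide_inverse mult.commute)
    then have "(\<lambda>m. \<Sum>j\<le>m. (-1) ^ j / fact j) \<longlonglongrightarrow> exp (-1 :: real)"
      by (simp add: sums_def_le)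
    then have "(\<lambda>n. (\<Sum>j\<le>n - k. (-1) ^ j / fact j) / fact k) \<longlonglongrightarrow> exp (-1 :: real) / fact k"
      by (intro tendsto_intros filterlim_compose[OF _ filterlim_minus_const_nat_at_top]) auto
    moreover have "eventually (\<lambda>n. (\<Sum>j\<le>n - k. (-1) ^ j / fact j) / fact k = p n k) sequentially"
      using eventually_ge_at_top[of "max 1 k"] by eventually_elim (simp add: p_eq)
    ultimately show ?thesis by (simp add: Lim_transform_eventually)
  qed
  have "(\<lambda>n. cdf (distr (M n) borel (\<lambda>\<omega>. real (Y n \<omega>))) x) \<longlonglongrightarrow> cdf (poisson_measure 1) x" for x
  proof -
    have "cdf (poisson_measure 1) x = (\<Sum>k | real k \<le> x. pmf (poisson_pmf 1) k)"
      unfolding poisson_measure_def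
      using cdf_distr_nat[of "measure_pmf (poisson_pmf 1)" "\<lambda>k. k" x]
      by (simp add: measure_pmf.finite_measure measure_pmf_single del: pmf_poisson)
    moreover have "(\<lambda>n. \<Sum>k | real k \<le> x. p n k) \<longlonglongrightarrow> (\<Sum>k | real k \<le> x. pmf (poisson_pmf 1) k)"
      by (intro tendsto_sum p_lim)
    moreover have "eventually (\<lambda>n. (\<Sum>k | real k \<le> x. p n k) =
        cdf (distr (M n) borel (\<lambda>\<omega>. real (Y n \<omega>))) x) sequentially"
      using eventually_ge_at_top[of 1]
    proof eventually_elim
      case (elim n)
      interpret prob_space "M n" using assms(1)[OF elim] .
      show ?case
        unfolding p_def using cdf_distr_nat[OF finite_measure_axioms Y[OF elim]] by simp
    qed
    ultimately show ?thesis by (simp add: Lim_transform_eventually)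
  qed
  then show ?thesis
    by (simp add: converges_in_law_def weak_conv_m_def weak_conv_def Y_def)
qed

end
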